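(* Let $K$ be a field, let $(\mathfrak{L},[,])$ be a (left) Leibniz algebra over $K$ and let $r=r^1\otimes r^2\in \mathfrak{L}\otimes \mathfrak{L}$ (summation understood). Define $\delta_r:\mathfrak{L}\to \mathfrak{L}\otimes \mathfrak{L}$ by $$\delta_r(x)=-r^{1}\otimes [r^{2}, x]+[r^{2}, x]\otimes r^{1}+[x, r^{2}]\otimes r^{1},\qquad x\in \mathfrak{L}.$$ Then $(\mathfrak{L},[,],\delta_r)$ is a Leibniz bialgebra if and only if the following three conditions hold for all $x,y\in\mathfrak{L}$: $$(R_x\otimes R_y)(r-\sigma(r))=0,$$ $$(L_x\otimes R_y+L_y\otimes L_x+R_y\otimes L_x)(r-\sigma(r))=0,$$ \begin{align*} &(\mathrm{id}\otimes L_x\otimes \mathrm{id}+\mathrm{id}\otimes R_x\otimes \mathrm{id})(r_{12}r^{\sigma}_{23}+r_{13}r^{\sigma}_{23}-r_{12}r^{\sigma}_{13}-r^{\sigma}_{13}r_{12})\\ &-(\mathrm{id}\otimes \mathrm{id}\otimes R_x)(r_{12}r_{23}+r_{13}r_{23}-r^{\sigma}_{12}r_{13}-r_{13}r^{\sigma}_{12})\\ &-(L_x\otimes \mathrm{id}\otimes \mathrm{id}+R_x\otimes \mathrm{id}\otimes \mathrm{id})(r_{23}r^{\sigma}_{13}+r^{\sigma}_{12}r^{\sigma}_{13}-r^{\sigma}_{23}r^{\sigma}_{12}-r^{\sigma}_{12}r^{\sigma}_{23})=0. \end{align*}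
   Context: All vector spaces, tensor products and linear maps are over a fixed field $K$; $\sigma$ denotes the flip map $\sigma(a\otimes b)=b\otimes a$. A (left) Leibniz algebra $(\mathfrak{L},[,])$ is a vector space with a bilinear bracket satisfying $[x,[y,z]]=[[x,y],z]+[y,[x,z]]$ for all $x,y,z$. Put $L_x(y)=[x,y]$ and $R_x(y)=[y,x]$. A Leibniz coalgebra $(\mathfrak{L},\delta)$ is a vector space with a linear map $\delta:\mathfrak{L}\to\mathfrak{L}\otimes\mathfrak{L}$, written $\delta(x)=x_{(1)}\otimes x_{(2)}$ (Sweedler notation, summation understood), such that for all $x$: $x_{(1)}\otimes x_{(2)(1)}\otimes x_{(2)(2)}=x_{(1)(1)}\otimes x_{(1)(2)}\otimes x_{(2)}+x_{(2)(1)}\otimes x_{(1)}\otimes x_{(2)(2)}$. A Leibniz bialgebra $(\mathfrak{L},[,],\delta)$ is a Leibniz algebra $(\mathfrak{L},[,])$ and a Leibniz coalgebra $(\mathfrak{L},\delta)$ such that for all $x,y\in\mathfrak{L}$: (i) $0=x_{(2)}\otimes [x_{(1)}, y]-[y_{(1)}, x]\otimes y_{(2)}$; (ii) $\delta([x,y])=x_{(1)}\otimes [x_{(2)}, y]-[y, x_{(1)}]\otimes x_{(2)}-[x_{(1)}, y]\otimes x_{(2)}+x_{(2)}\otimes [x_{(1)}, y]-[y, x_{(2)}]\otimes x_{(1)}-[x_{(2)}, y]\otimes x_{(1)}+[x, y_{(1)}]\otimes y_{(2)}+y_{(1)}\otimes [x, y_{(2)}]$. Tensor notation: for $s=s^1\otimes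 s^2$ and $t=t^1\otimes t^2$ in $\mathfrak{L}\otimes\mathfrak{L}$ (summations understood), $s_{12}t_{23}=s^1\otimes[s^2,t^1]\otimes t^2$, $s_{13}t_{23}=s^1\otimes t^1\otimes[s^2,t^2]$, $s_{23}t_{12}=t^1\otimes[s^1,t^2]\otimes s^2$, $s_{23}t_{13}=t^1\otimes s^1\otimes[s^2,t^2]$, $s_{12}t_{13}=[s^1,t^1]\otimes s^2\otimes t^2$, $s_{13}t_{12}=[s^1,t^1]\otimes t^2\otimes s^2$. Here each of $s,t$ is $r$ or $r^\sigma:=\sigma(r)=r^2\otimes r^1$; $r^{\sigma}_{ij}$ means $(r^\sigma)_{ij}$. *)

theory Defs
  imports Complex_Main "HOL-Library.Poly_Mapping"
begin

section \<open>Free vector spaces and their quotients\<close>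

text \<open>The free vector space on a type \<open>'b\<close> over the field \<open>'k\<close> is \<open>'b \<Rightarrow>\<^sub>0 'k\<close>.\<close>

definition free_scale :: "'k::field \<Rightarrow> ('b \<Rightarrow>\<^sub>0 'k) \<Rightarrow> ('b \<Rightarrow>\<^sub>0 'k)" where
  "free_scale c f = Poly_Mapping.map ((*) c) f"

lemma lookup_free_scale [simp]:
  "Poly_Mapping.lookup (free_scale c f) b = c * Poly_Mapping.lookup f b"
  by (simp add: free_scale_def Poly_Mapping.map.rep_eq when_def)

interpretation free: vector_space "free_scale :: 'k::field \<Rightarrow> ('b \<Rightarrow>\<^sub>0 'k) \<Rightarrow> ('b \<Rightarrow>\<^sub>0 'k)"
  by unfold_locales
    (auto intro!: poly_mapping_eqI simp: Poly_Mapping.lookup_add algebra_simps)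

text \<open>
  A type cannot depend on the scalar multiplication of a vector space, so a quotient of a free
  vector space by a subspace \<open>N\<close> is the set of cosets of \<open>N\<close>, with the operations below.
  The sum of two cosets needs no mention of \<open>N\<close>, because \<open>N + N = N\<close>; the
  scalar multiple does, because \<open>0\<close> times a coset has to be \<open>N\<close>.
\<close>

definition coset :: "('b \<Rightarrow>\<^sub>0 'k::field) set \<Rightarrow> ('b \<Rightarrow>\<^sub>0 'k) \<Rightarrow> ('b \<Rightarrow>\<^sub>0 'k) set" where
  "coset N f = {g. g - f \<in> N}"

definition coset_add :: "('b \<Rightarrow>\<^sub>0 'k::field) set \<Rightarrow> ('b \<Rightarrow>\<^sub>0 'k) set \<Rightarrow> ('b \<Rightarrow>\<^sub>0 'k) set"
    (infixl "\<oplus>" 65) where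
  "A \<oplus> B = {f + g | f g. f \<in> A \<and> g \<in> B}"

definition coset_uminus :: "('b \<Rightarrow>\<^sub>0 'k::field) set \<Rightarrow> ('b \<Rightarrow>\<^sub>0 'k) set"
    ("\<ominus> _" [81] 80) where
  "\<ominus> A = {- f | f. f \<in> A}"

definition coset_minus :: "('b \<Rightarrow>\<^sub>0 'k::field) set \<Rightarrow> ('b \<Rightarrow>\<^sub>0 'k) set \<Rightarrow> ('b \<Rightarrow>\<^sub>0 'k) set"
    (infixl "\<ominus>" 65) where
  "A \<ominus> B = {f - g | f g. f \<in> A \<and> g \<in> B}"

definition coset_scale ::
    "('b \<Rightarrow>\<^sub>0 'k::field) set \<Rightarrow> 'k \<Rightarrow> ('b \<Rightarrow>\<^sub>0 'k) set \<Rightarrow> ('b \<Rightarrow>\<^sub>0 'k) set" where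
  "coset_scale N c A = {free_scale c f + n | f n. f \<in> A \<and> n \<in> N}"

definition coset_rep :: "('b \<Rightarrow>\<^sub>0 'k::field) set \<Rightarrow> ('b \<Rightarrow>\<^sub>0 'k)" where
  "coset_rep A = (SOME f. f \<in> A)"

text \<open>
  The Sweedler summation convention. If \<open>t\<close> is the class of a formal sum
  \<open>\<Sum>\<^sub>i c\<^sub>i b\<^sub>i\<close> then \<open>sweedler N t \<beta>\<close> is
  \<open>\<Sum>\<^sub>i c\<^sub>i \<beta>(b\<^sub>i)\<close> in the quotient by \<open>N\<close>. For multilinear \<open>\<beta>\<close> this is the value at \<open>t\<close>
  of the linear map on the tensor product induced by \<open>\<beta>\<close>, independently of the chosen
  formal sum: see \<open>sweedler_coset\<close>, \<open>sweedler_tens2\<close> and \<open>sweedler_tens3\<close>.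
\<close>

definition free_extend :: "('b \<Rightarrow> ('c \<Rightarrow>\<^sub>0 'k::field)) \<Rightarrow> ('b \<Rightarrow>\<^sub>0 'k) \<Rightarrow> ('c \<Rightarrow>\<^sub>0 'k)" where
  "free_extend g f =
     (\<Sum>b\<in>Poly_Mapping.keys f. free_scale (Poly_Mapping.lookup f b) (g b))"

definition sweedler ::
    "('c \<Rightarrow>\<^sub>0 'k::field) set \<Rightarrow> ('b \<Rightarrow>\<^sub>0 'k) set \<Rightarrow> ('b \<Rightarrow> ('c \<Rightarrow>\<^sub>0 'k) set) \<Rightarrow> ('c \<Rightarrow>\<^sub>0 'k) set" where
  "sweedler N t \<beta> = coset N (free_extend (\<lambda>b. coset_rep (\<beta> b)) (coset_rep t))"


section \<open>The tensor products \<open>L \<otimes> L\<close> and \<open>L \<otimes> L \<otimes> L\<close>\<close>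

abbreviation gen2 :: "'v \<Rightarrow> 'v \<Rightarrow> ('v \<times> 'v \<Rightarrow>\<^sub>0 'k::field)" where
  "gen2 a b \<equiv> Poly_Mapping.single (a, b) 1"

abbreviation gen3 :: "'v \<Rightarrow> 'v \<Rightarrow> 'v \<Rightarrow> ('v \<times> 'v \<times> 'v \<Rightarrow>\<^sub>0 'k::field)" where
  "gen3 a b c \<equiv> Poly_Mapping.single (a, b, c) 1"

definition tensor2_rel :: "('k::field \<Rightarrow> 'v::ab_group_add \<Rightarrow> 'v) \<Rightarrow> ('v \<times> 'v \<Rightarrow>\<^sub>0 'k) set" where
  "tensor2_rel scale = free.span (
      {gen2 (a + a') b - gen2 a b - gen2 a' b | a a' b. True}
    \<union> {gen2 a (b + b') - gen2 a b - gen2 a b' | a b b'. True}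
    \<union> {gen2 (scale k a) b - free_scale k (gen2 a b) | k a b. True}
    \<union> {gen2 a (scale k b) - free_scale k (gen2 a b) | k a b. True})"

definition tensor3_rel ::
    "('k::field \<Rightarrow> 'v::ab_group_add \<Rightarrow> 'v) \<Rightarrow> ('v \<times> 'v \<times> 'v \<Rightarrow>\<^sub>0 'k) set" where
  "tensor3_rel scale = free.span (
      {gen3 (a + a') b c - gen3 a b c - gen3 a' b c | a a' b c. True}
    \<union> {gen3 a (b + b') c - gen3 a b c - gen3 a b' c | a b b' c. True}
    \<union> {gen3 a b (c + c') - gen3 a b c - gen3 a b c' | a b c c'. True}
    \<union> {gen3 (scale k a) b c - free_scale k (gen3 a b c) | k a b c. True}
    \<union> {gen3 a (scale k b) c - free_scale k (gen3 a b c) | k a b c. True}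
    \<union> {gen3 a b (scale k c) - free_scale k (gen3 a b c) | k a b c. True})"

definition tensor2 :: "('k::field \<Rightarrow> 'v::ab_group_add \<Rightarrow> 'v) \<Rightarrow> ('v \<times> 'v \<Rightarrow>\<^sub>0 'k) set set" where
  "tensor2 scale = range (coset (tensor2_rel scale))"

definition tens2 ::
    "('k::field \<Rightarrow> 'v::ab_group_add \<Rightarrow> 'v) \<Rightarrow> 'v \<Rightarrow> 'v \<Rightarrow> ('v \<times> 'v \<Rightarrow>\<^sub>0 'k) set" where
  "tens2 scale a b = coset (tensor2_rel scale) (gen2 a b)"

definition tens3 ::
    "('k::field \<Rightarrow> 'v::ab_group_add \<Rightarrow> 'v) \<Rightarrow> 'v \<Rightarrow> 'v \<Rightarrow> 'v \<Rightarrow> ('v \<times> 'v \<times> 'v \<Rightarrow>\<^sub>0 'k) set" where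
  "tens3 scale a b c = coset (tensor3_rel scale) (gen3 a b c)"

definition zero2 :: "('k::field \<Rightarrow> 'v::ab_group_add \<Rightarrow> 'v) \<Rightarrow> ('v \<times> 'v \<Rightarrow>\<^sub>0 'k) set" where
  "zero2 scale = coset (tensor2_rel scale) 0"

definition zero3 :: "('k::field \<Rightarrow> 'v::ab_group_add \<Rightarrow> 'v) \<Rightarrow> ('v \<times> 'v \<times> 'v \<Rightarrow>\<^sub>0 'k) set" where
  "zero3 scale = coset (tensor3_rel scale) 0"

text \<open>Sweedler sums over an element of \<open>L \<otimes> L\<close>, with values in \<open>L \<otimes> L\<close> and in
  \<open>L \<otimes> L \<otimes> L\<close>.\<close>

definition sum22 :: "('k::field \<Rightarrow> 'v::ab_group_add \<Rightarrow> 'v) \<Rightarrow> ('v \<times> 'v \<Rightarrow>\<^sub>0 'k) set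
    \<Rightarrow> ('v \<Rightarrow> 'v \<Rightarrow> ('v \<times> 'v \<Rightarrow>\<^sub>0 'k) set) \<Rightarrow> ('v \<times> 'v \<Rightarrow>\<^sub>0 'k) set" where
  "sum22 scale t \<beta> = sweedler (tensor2_rel scale) t (\<lambda>(a, b). \<beta> a b)"

definition sum23 :: "('k::field \<Rightarrow> 'v::ab_group_add \<Rightarrow> 'v) \<Rightarrow> ('v \<times> 'v \<Rightarrow>\<^sub>0 'k) set
    \<Rightarrow> ('v \<Rightarrow> 'v \<Rightarrow> ('v \<times> 'v \<times> 'v \<Rightarrow>\<^sub>0 'k) set) \<Rightarrow> ('v \<times> 'v \<times> 'v \<Rightarrow>\<^sub>0 'k) set" where
  "sum23 scale t \<beta> = sweedler (tensor3_rel scale) t (\<lambda>(a, b). \<beta> a b)"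

definition flip2 ::
    "('k::field \<Rightarrow> 'v::ab_group_add \<Rightarrow> 'v) \<Rightarrow> ('v \<times> 'v \<Rightarrow>\<^sub>0 'k) set \<Rightarrow> ('v \<times> 'v \<Rightarrow>\<^sub>0 'k) set" where
  "flip2 scale t = sum22 scale t (\<lambda>a b. tens2 scale b a)"

definition tmap2 :: "('k::field \<Rightarrow> 'v::ab_group_add \<Rightarrow> 'v) \<Rightarrow> ('v \<Rightarrow> 'v) \<Rightarrow> ('v \<Rightarrow> 'v)
    \<Rightarrow> ('v \<times> 'v \<Rightarrow>\<^sub>0 'k) set \<Rightarrow> ('v \<times> 'v \<Rightarrow>\<^sub>0 'k) set" where
  "tmap2 scale f g t = sum22 scale t (\<lambda>a b. tens2 scale (f a) (g b))"

definition tmap3 :: "('k::field \<Rightarrow> 'v::ab_group_add \<Rightarrow> 'v) \<Rightarrow> ('v \<Rightarrow> 'v) \<Rightarrow> ('v \<Rightarrow> 'v) \<Rightarrow> ('v \<Rightarrow> 'v)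
    \<Rightarrow> ('v \<times> 'v \<times> 'v \<Rightarrow>\<^sub>0 'k) set \<Rightarrow> ('v \<times> 'v \<times> 'v \<Rightarrow>\<^sub>0 'k) set" where
  "tmap3 scale f g h t =
     sweedler (tensor3_rel scale) t (\<lambda>(a, b, c). tens3 scale (f a) (g b) (h c))"

subsection \<open>Sweedler sums are the induced linear maps\<close>

lemma coset_eq_iff:
  assumes "free.subspace N"
  shows "coset N f = coset N g \<longleftrightarrow> f - g \<in> N"
proof
  assume "coset N f = coset N g"
  moreover have "f \<in> coset N f"
    using assms by (simp add: coset_def free.subspace_0)
  ultimately show "f - g \<in> N" by (simp add: coset_def)
next
  assume *: "f - g \<in> N"
  show "coset N f = coset N g"
    unfolding coset_def
  proof (intro Collect_cong iffI)
    fix h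
    { assume "h - f \<in> N"
      from free.subspace_add[OF assms this *] show "h - g \<in> N" by simp }
    { assume "h - g \<in> N"
      from free.subspace_diff[OF assms this *] show "h - f \<in> N" by simp }
  qed
qed

lemma coset_rep_coset:
  assumes "free.subspace N"
  shows "coset_rep (coset N f) - f \<in> N"
proof -
  have "f \<in> coset N f" using assms by (simp add: coset_def free.subspace_0)
  hence "coset_rep (coset N f) \<in> coset N f" unfolding coset_rep_def by (rule someI)
  thus ?thesis by (simp add: coset_def)
qed

lemma free_extend_superset:
  assumes "finite S" "Poly_Mapping.keys f \<subseteq> S"
  shows "free_extend g f = (\<Sum>b\<in>S. free_scale (Poly_Mapping.lookup f b) (g b))"
  unfolding free_extend_def
  by (rule sum.mono_neutral_left) (use assms in \<open>auto simp: in_keys_iff\<close>)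

lemma free_extend_add: "free_extend g (f + f') = free_extend g f + free_extend g f'"
proof -
  let ?S = "Poly_Mapping.keys f \<union> Poly_Mapping.keys f' \<union> Poly_Mapping.keys (f + f')"
  have "free_extend g h = (\<Sum>b\<in>?S. free_scale (Poly_Mapping.lookup h b) (g b))"
    if "h \<in> {f, f', f + f'}" for h
    using that by (intro free_extend_superset) auto
  thus ?thesis
    by (simp add: Poly_Mapping.lookup_add free.scale_left_distrib sum.distrib)
qed

lemma free_extend_scale: "free_extend g (free_scale k f) = free_scale k (free_extend g f)"
proof -
  have "Poly_Mapping.keys (free_scale k f) \<subseteq> Poly_Mapping.keys f"
    by (auto simp: in_keys_iff)
  hence "free_extend g (free_scale k f) =
      (\<Sum>b\<in>Poly_Mapping.keys f. free_scale (Poly_Mapping.lookup (free_scale k f) b) (g b))"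
    by (intro free_extend_superset) auto
  thus ?thesis by (simp add: free_extend_def free.scale_sum_right)
qed

lemma free_extend_diff: "free_extend g (f - f') = free_extend g f - free_extend g f'"
  using free_extend_add[of g "f - f'" f'] by (simp add: algebra_simps)

lemma free_extend_single [simp]: "free_extend g (Poly_Mapping.single b c) = free_scale c (g b)"
  by (cases "c = 0") (simp_all add: free_extend_def)

lemma free_extend_span:
  assumes "free.subspace N" "\<And>f. f \<in> S \<Longrightarrow> free_extend g f \<in> N" "f \<in> free.span S"
  shows "free_extend g f \<in> N"
  using assms(3)
proof (induction rule: free.span_induct_alt)
  case base
  show ?case using assms(1) by (simp add: free_extend_def free.subspace_0)
next
  case (step c x y)
  thus ?case
    using assms(1,2) by (simp add: free_extend_add free_extend_scale
        free.subspace_add free.subspace_scale)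
qed

text \<open>Independence of the chosen formal sum and of the chosen representatives of the values.\<close>

lemma sweedler_coset:
  assumes M: "free.subspace M" and N: "free.subspace N"
    and \<beta>: "\<And>b. \<beta> b = coset N (g b)"
    and g: "\<And>f. f \<in> M \<Longrightarrow> free_extend g f \<in> N"
  shows "sweedler N (coset M f) \<beta> = coset N (free_extend g f)"
proof -
  let ?h = "\<lambda>b. coset_rep (\<beta> b)" and ?f = "coset_rep (coset M f)"
  have "free_extend ?h ?f - free_extend g ?f =
      (\<Sum>b\<in>Poly_Mapping.keys ?f. free_scale (Poly_Mapping.lookup ?f b) (?h b - g b))"
    by (simp add: free_extend_def sum_subtractf free.scale_right_diff_distrib)
  also have "\<dots> \<in> N"
    using coset_rep_coset[OF N] by (intro free.subspace_sum free.subspace_scale N) (simp add: \<beta>)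
  finally have 1: "free_extend ?h ?f - free_extend g ?f \<in> N" .
  have 2: "free_extend g ?f - free_extend g f \<in> N"
    using g[OF coset_rep_coset[OF M, of f]] by (simp add: free_extend_diff)
  show ?thesis
    unfolding sweedler_def coset_eq_iff[OF N]
    using free.subspace_add[OF N 1 2] by simp
qed

lemma sweedler_tens2:
  fixes scale :: "'k::field \<Rightarrow> 'v::ab_group_add \<Rightarrow> 'v"
  assumes N: "free.subspace N"
    and \<beta>: "\<And>a b. \<beta> a b = coset N (g a b)"
    and "\<And>a a' b. g (a + a') b - g a b - g a' b \<in> N"
    and "\<And>a b b'. g a (b + b') - g a b - g a b' \<in> N"
    and "\<And>k a b. g (scale k a) b - free_scale k (g a b) \<in> N"
    and "\<And>k a b. g a (scale k b) - free_scale k (g a b) \<in> N"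
  shows "sweedler N (coset (tensor2_rel scale) f) (\<lambda>(a, b). \<beta> a b) =
      coset N (free_extend (\<lambda>(a, b). g a b) f)"
    and "sweedler N (tens2 scale a b) (\<lambda>(a, b). \<beta> a b) = \<beta> a b"
proof -
  have *: "free_extend (\<lambda>(a, b). g a b) f \<in> N" if "f \<in> tensor2_rel scale" for f
    using that unfolding tensor2_rel_def
    by (rule free_extend_span[OF N, rotated])
      (use assms in \<open>auto simp: free_extend_diff free_extend_scale\<close>)
  have M: "free.subspace (tensor2_rel scale)" by (simp add: tensor2_rel_def)
  show **: "sweedler N (coset (tensor2_rel scale) f) (\<lambda>(a, b). \<beta> a b) =
      coset N (free_extend (\<lambda>(a, b). g a b) f)" for f
    by (rule sweedler_coset[OF M N]) (use * \<beta> in auto)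
  show "sweedler N (tens2 scale a b) (\<lambda>(a, b). \<beta> a b) = \<beta> a b"
    by (simp only: tens2_def **) (simp add: \<beta>)
qed

lemma sweedler_tens3:
  fixes scale :: "'k::field \<Rightarrow> 'v::ab_group_add \<Rightarrow> 'v"
  assumes N: "free.subspace N"
    and \<beta>: "\<And>a b c. \<beta> a b c = coset N (g a b c)"
    and "\<And>a a' b c. g (a + a') b c - g a b c - g a' b c \<in> N"
    and "\<And>a b b' c. g a (b + b') c - g a b c - g a b' c \<in> N"
    and "\<And>a b c c'. g a b (c + c') - g a b c - g a b c' \<in> N"
    and "\<And>k a b c. g (scale k a) b c - free_scale k (g a b c) \<in> N"
    and "\<And>k a b c. g a (scale k b) c - free_scale k (g a b c) \<in> N"
    and "\<And>k a b c. g a b (scale k c) - free_scale k (g a b c) \<in> N"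
  shows "sweedler N (coset (tensor3_rel scale) f) (\<lambda>(a, b, c). \<beta> a b c) =
      coset N (free_extend (\<lambda>(a, b, c). g a b c) f)"
    and "sweedler N (tens3 scale a b c) (\<lambda>(a, b, c). \<beta> a b c) = \<beta> a b c"
proof -
  have *: "free_extend (\<lambda>(a, b, c). g a b c) f \<in> N" if "f \<in> tensor3_rel scale" for f
    using that unfolding tensor3_rel_def
    by (rule free_extend_span[OF N, rotated])
      (use assms in \<open>auto simp: free_extend_diff free_extend_scale\<close>)
  have M: "free.subspace (tensor3_rel scale)" by (simp add: tensor3_rel_def)
  show **: "sweedler N (coset (tensor3_rel scale) f) (\<lambda>(a, b, c). \<beta> a b c) =
      coset N (free_extend (\<lambda>(a, b, c). g a b c) f)" for f
    by (rule sweedler_coset[OF M N]) (use * \<beta> in auto)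
  show "sweedler N (tens3 scale a b c) (\<lambda>(a, b, c). \<beta> a b c) = \<beta> a b c"
    by (simp only: tens3_def **) (simp add: \<beta>)
qed


section \<open>Leibniz algebras, coalgebras and bialgebras\<close>

locale leibniz_algebra = vector_space scale
  for scale :: "'k::field \<Rightarrow> 'v::ab_group_add \<Rightarrow> 'v" +
  fixes br :: "'v \<Rightarrow> 'v \<Rightarrow> 'v"
  assumes linear_right: "Vector_Spaces.linear scale scale (\<lambda>y. br x y)"
    and linear_left: "Vector_Spaces.linear scale scale (\<lambda>x. br x y)"
    and left_leibniz: "br x (br y z) = br (br x y) z + br y (br x z)"

definition opL :: "('v \<Rightarrow> 'v \<Rightarrow> 'v) \<Rightarrow> 'v \<Rightarrow> 'v \<Rightarrow> 'v" where
  "opL br x y = br x y"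

definition opR :: "('v \<Rightarrow> 'v \<Rightarrow> 'v) \<Rightarrow> 'v \<Rightarrow> 'v \<Rightarrow> 'v" where
  "opR br x y = br y x"

locale leibniz_coalgebra = vector_space scale
  for scale :: "'k::field \<Rightarrow> 'v::ab_group_add \<Rightarrow> 'v" +
  fixes \<delta> :: "'v \<Rightarrow> ('v \<times> 'v \<Rightarrow>\<^sub>0 'k) set"
  assumes delta_tensor2: "\<delta> x \<in> tensor2 scale"
    and delta_add: "\<delta> (x + y) = \<delta> x \<oplus> \<delta> y"
    and delta_scale: "\<delta> (scale k x) = coset_scale (tensor2_rel scale) k (\<delta> x)"
    and co_leibniz:
      "sum23 scale (\<delta> x) (\<lambda>x1 x2. sum23 scale (\<delta> x2) (\<lambda>x21 x22. tens3 scale x1 x21 x22)) =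
       sum23 scale (\<delta> x) (\<lambda>x1 x2. sum23 scale (\<delta> x1) (\<lambda>x11 x12. tens3 scale x11 x12 x2)) \<oplus>
       sum23 scale (\<delta> x) (\<lambda>x1 x2. sum23 scale (\<delta> x2) (\<lambda>x21 x22. tens3 scale x21 x1 x22))"

locale leibniz_bialgebra = leibniz_algebra scale br + leibniz_coalgebra scale \<delta>
  for scale :: "'k::field \<Rightarrow> 'v::ab_group_add \<Rightarrow> 'v"
    and br :: "'v \<Rightarrow> 'v \<Rightarrow> 'v"
    and \<delta> :: "'v \<Rightarrow> ('v \<times> 'v \<Rightarrow>\<^sub>0 'k) set" +
  assumes compat_zero:
      "zero2 scale = sum22 scale (\<delta> x) (\<lambda>x1 x2. tens2 scale x2 (br x1 y))
                   \<ominus> sum22 scale (\<delta> y) (\<lambda>y1 y2. tens2 scale (br y1 x) y2)"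
    and compat_bracket:
      "\<delta> (br x y) =
         sum22 scale (\<delta> x) (\<lambda>x1 x2. tens2 scale x1 (br x2 y))
       \<ominus> sum22 scale (\<delta> x) (\<lambda>x1 x2. tens2 scale (br y x1) x2)
       \<ominus> sum22 scale (\<delta> x) (\<lambda>x1 x2. tens2 scale (br x1 y) x2)
       \<oplus> sum22 scale (\<delta> x) (\<lambda>x1 x2. tens2 scale x2 (br x1 y))
       \<ominus> sum22 scale (\<delta> x) (\<lambda>x1 x2. tens2 scale (br y x2) x1)
       \<ominus> sum22 scale (\<delta> x) (\<lambda>x1 x2. tens2 scale (br x2 y) x1)
       \<oplus> sum22 scale (\<delta> y) (\<lambda>y1 y2. tens2 scale (br x y1) y2)
       \<oplus> sum22 scale (\<delta> y) (\<lambda>y1 y2. tens2 scale y1 (br x y2))"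

definition delta_r :: "('k::field \<Rightarrow> 'v::ab_group_add \<Rightarrow> 'v) \<Rightarrow> ('v \<Rightarrow> 'v \<Rightarrow> 'v)
    \<Rightarrow> ('v \<times> 'v \<Rightarrow>\<^sub>0 'k) set \<Rightarrow> 'v \<Rightarrow> ('v \<times> 'v \<Rightarrow>\<^sub>0 'k) set" where
  "delta_r scale br r x =
       \<ominus> sum22 scale r (\<lambda>r1 r2. tens2 scale r1 (br r2 x))
       \<oplus> sum22 scale r (\<lambda>r1 r2. tens2 scale (br r2 x) r1)
       \<oplus> sum22 scale r (\<lambda>r1 r2. tens2 scale (br x r2) r1)"

text \<open>
  The products \<open>s\<^sub>i\<^sub>j t\<^sub>k\<^sub>l\<close> in \<open>L \<otimes> L \<otimes> L\<close>: the factors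
  of \<open>s\<close> sit in places \<open>i, j\<close>, those of \<open>t\<close> in places \<open>k, l\<close>, and in the shared place the
  entry of \<open>s\<close> is bracketed with that of \<open>t\<close>, in this order.
\<close>

context
  fixes scale :: "'k::field \<Rightarrow> 'v::ab_group_add \<Rightarrow> 'v"
    and br :: "'v \<Rightarrow> 'v \<Rightarrow> 'v"
    and s t :: "('v \<times> 'v \<Rightarrow>\<^sub>0 'k) set"
begin

definition prod12_23 where
  "prod12_23 = sum23 scale s (\<lambda>s1 s2. sum23 scale t (\<lambda>t1 t2. tens3 scale s1 (br s2 t1) t2))"

definition prod13_23 where
  "prod13_23 = sum23 scale s (\<lambda>s1 s2. sum23 scale t (\<lambda>t1 t2. tens3 scale s1 t1 (br s2 t2)))"

definition prod23_12 where
  "prod23_12 = sum23 scale s (\<lambda>s1 s2. sum23 scale t (\<lambda>t1 t2. tens3 scale t1 (br s1 t2) s2))"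

definition prod23_13 where
  "prod23_13 = sum23 scale s (\<lambda>s1 s2. sum23 scale t (\<lambda>t1 t2. tens3 scale t1 s1 (br s2 t2)))"

definition prod12_13 where
  "prod12_13 = sum23 scale s (\<lambda>s1 s2. sum23 scale t (\<lambda>t1 t2. tens3 scale (br s1 t1) s2 t2))"

definition prod13_12 where
  "prod13_12 = sum23 scale s (\<lambda>s1 s2. sum23 scale t (\<lambda>t1 t2. tens3 scale (br s1 t1) t2 s2))"

end

end

theory Submission
  imports Defs
begin

text \<open>
  Write \<open>r = \<Sum>\<^sub>i a\<^sub>i \<otimes> b\<^sub>i\<close> and compute. For each of the three bialgebra axioms, the
  difference of its two sides for \<open>\<delta>\<^sub>r\<close> is \<^emph>\<open>equal\<close>, as an element of a tensor
  power, to the left-hand side of one of the three conditions. So the axioms and the conditions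
  match one by one: see \<open>compat_zero_iff\<close>, \<open>compat_bracket_iff\<close> and \<open>co_leibniz_iff\<close>. That \<open>\<delta>\<^sub>r\<close> is linear is automatic.

  The algebra behind the three computations is the Leibniz rule in the form
  \<open>[[x, y], z] = [x, [y, z]] - [y, [x, z]]\<close>, that is \<open>L\<^bsub>[x, y]\<^esub> = [L\<^sub>x, L\<^sub>y]\<close>. It rewrites
  every iterated bracket to right-nested ones, and it kills \<open>[[x, y] + [y, x], z]\<close>. In the first
  axiom the last fact removes the double brackets, so that only
  \<open>(R\<^sub>x \<otimes> R\<^sub>y)(r - \<sigma>(r))\<close> is left. In the second one, the terms with \<open>x\<close> and \<open>y\<close> in
  the same tensor factor cancel by the Leibniz rule, and the mixed terms that survive are those of
  the second condition. In the co-Leibniz identity, \<open>\<delta>\<^sub>r\<close> is used twice, so the terms are indexed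
  by two copies of \<open>r\<close>; sorted by the tensor factor in which \<open>x\<close> occurs, they give the three
  groups of the third condition. Some terms match only after the two copies of
  \<open>r\<close> have been interchanged, which is what \<open>sum_sum_eqI_antisym\<close> handles.

  Elements of the tensor powers are cosets of a subspace \<open>N\<close> of a free vector space, and cosets
  do not form a type with an addition of its own. Therefore equations between cosets are
  transported along a linear endomorphism \<open>proj N\<close> of the free space whose kernel is \<open>N\<close>: two
  formal sums have the same coset if and only if their images coincide. The images \<open>t2 a b\<close> and
  \<open>t3 a b c\<close> of the generators are multilinear on the nose, and every identity becomes one between
  finite sums in an abelian group.
\<close>

section \<open>Cosets as values of a linear projection\<close>

text \<open>
  Extend a basis \<open>B\<close> of \<open>N\<close> to a basis \<open>C\<close> of the whole space, and let \<open>p\<close> kill \<open>B\<close> and fix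
  the rest of \<open>C\<close>. Then \<open>x - p x \<in> N\<close> for all \<open>x\<close>, so that \<open>p x = 0\<close> forces \<open>x \<in> N\<close>.
\<close>

lemma (in vector_space) subspace_is_kernel:
  assumes "subspace N"
  shows "\<exists>p. Vector_Spaces.linear scale scale p \<and> (\<forall>x. p x = 0 \<longleftrightarrow> x \<in> N)"
proof -
  interpret pair: vector_space_pair scale scale ..
  obtain B where B: "B \<subseteq> N" "independent B" "span B = N"
  proof -
    obtain B where "B \<subseteq> N" "independent B" "N \<subseteq> span B"
      using maximal_independent_subset by blast
    thus ?thesis using that span_minimal[OF _ assms] by blast
  qed
  define C where "C = extend_basis B"
  have C: "B \<subseteq> C" "independent C" "span C = UNIV"
    unfolding C_def using B(2)
    by (simp_all add: extend_basis_superset independent_extend_basis)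
  obtain p where p: "Vector_Spaces.linear scale scale p"
    and p_basis: "\<And>c. c \<in> C \<Longrightarrow> p c = (if c \<in> B then 0 else c)"
    using pair.linear_independent_extend[OF C(2), of "\<lambda>c. if c \<in> B then 0 else c"] by blast
  have "p x = 0" if "x \<in> N" for x
    using pair.linear_eq_0_on_span[OF p, of B x] p_basis that B(3) C(1) by (metis subsetD)
  moreover have "x - p x \<in> N" for x
  proof -
    have "x \<in> span C" using C by simp
    thus ?thesis
    proof (induction rule: span_induct_alt)
      case base
      show ?case using pair.linear_0[OF p] subspace_0[OF assms] by simp
    next
      case (step k c y)
      have "c - p c \<in> N"
        using step p_basis B subspace_0[OF assms] by auto
      hence "scale k (c - p c) + (y - p y) \<in> N"
        using step by (intro subspace_add subspace_scale assms)
      thus ?case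
        by (simp add: pair.linear_add[OF p] pair.linear_scale[OF p] scale_right_diff_distrib algebra_simps)
    qed
  qed
  hence "x \<in> N" if "p x = 0" for x using that by (metis diff_zero)
  ultimately show ?thesis using p by blast
qed

text \<open>
  The range of such a map is a model of the quotient by \<open>N\<close> that lives in a type with the
  usual operations.
\<close>

definition proj :: "('b \<Rightarrow>\<^sub>0 'k::field) set \<Rightarrow> ('b \<Rightarrow>\<^sub>0 'k) \<Rightarrow> ('b \<Rightarrow>\<^sub>0 'k)" where
  "proj N = (SOME p. Vector_Spaces.linear free_scale free_scale p \<and> (\<forall>f. p f = 0 \<longleftrightarrow> f \<in> N))"

context
  fixes N :: "('b \<Rightarrow>\<^sub>0 'k::field) set"
  assumes N: "free.subspace N"
begin

lemma linear_proj: "Vector_Spaces.linear free_scale free_scale (proj N)"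
  and proj_eq_0_iff: "proj N f = 0 \<longleftrightarrow> f \<in> N"
  using someI_ex[OF free.subspace_is_kernel[OF N]] unfolding proj_def by auto

interpretation proj: Vector_Spaces.linear free_scale free_scale "proj N"
  by (rule linear_proj)

lemma proj_add: "proj N (f + g) = proj N f + proj N g"
  by (rule proj.add)

lemma proj_scale: "proj N (free_scale k f) = free_scale k (proj N f)"
  by (rule proj.scale)

lemma proj_0: "proj N 0 = 0"
  using proj_eq_0_iff[of 0] N by (simp add: free.subspace_0)

lemma proj_minus: "proj N (- f) = - proj N f"
  using proj_add[of f "- f"] by (simp add: proj_0 eq_neg_iff_add_eq_0 add.commute)

lemma proj_diff: "proj N (f - g) = proj N f - proj N g"
  using proj_add[of f "- g"] by (simp add: proj_minus)

lemma proj_sum: "proj N (\<Sum>i\<in>I. f i) = (\<Sum>i\<in>I. proj N (f i))"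
  by (induction I rule: infinite_finite_induct) (auto simp: proj_0 proj_add)

lemma coset_eq_iff_proj: "coset N f = coset N g \<longleftrightarrow> proj N f = proj N g"
  by (simp add: coset_eq_iff[OF N] flip: proj_eq_0_iff) (simp add: proj_diff)

lemma coset_altdef: "coset N f = {g. proj N g = proj N f}"
  by (simp add: coset_def flip: proj_eq_0_iff) (simp add: proj_diff)

lemma coset_add_coset: "coset N f \<oplus> coset N g = coset N (f + g)"
proof (intro set_eqI iffI)
  fix h assume "h \<in> coset N (f + g)"
  hence "h - g \<in> coset N f" "g \<in> coset N g" by (auto simp: coset_altdef proj_add proj_diff)
  thus "h \<in> coset N f \<oplus> coset N g"
    unfolding coset_add_def by (metis (mono_tags, lifting) diff_add_cancel mem_Collect_eq)
qed (auto simp: coset_add_def coset_altdef proj_add)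

lemma coset_uminus_coset: "\<ominus> coset N f = coset N (- f)"
proof (intro set_eqI iffI)
  fix h assume "h \<in> coset N (- f)"
  hence "- h \<in> coset N f" by (auto simp: coset_altdef proj_minus)
  thus "h \<in> \<ominus> coset N f"
    unfolding coset_uminus_def by (metis (mono_tags, lifting) minus_minus mem_Collect_eq)
qed (auto simp: coset_uminus_def coset_altdef proj_minus)

lemma coset_minus_coset: "coset N f \<ominus> coset N g = coset N (f - g)"
proof (intro set_eqI iffI)
  fix h assume "h \<in> coset N (f - g)"
  hence "h + g \<in> coset N f" "g \<in> coset N g" by (auto simp: coset_altdef proj_add proj_diff)
  thus "h \<in> coset N f \<ominus> coset N g"
    unfolding coset_minus_def by (metis (mono_tags, lifting) add_diff_cancel mem_Collect_eq)
qed (auto simp: coset_minus_def coset_altdef proj_diff)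

lemma coset_scale_coset: "coset_scale N k (coset N f) = coset N (free_scale k f)"
proof (intro set_eqI iffI)
  fix h assume "h \<in> coset N (free_scale k f)"
  hence "h - free_scale k f \<in> N" "f \<in> coset N f" by (auto simp: coset_def free.subspace_0[OF N])
  thus "h \<in> coset_scale N k (coset N f)" unfolding coset_scale_def
    by (smt (verit) add.commute diff_add_cancel mem_Collect_eq)
next
  fix h assume "h \<in> coset_scale N k (coset N f)"
  then obtain g n where "h = free_scale k g + n" "proj N g = proj N f" "n \<in> N"
    unfolding coset_scale_def coset_altdef by auto
  thus "h \<in> coset N (free_scale k f)"
    by (simp add: coset_altdef proj_add proj_scale flip: proj_eq_0_iff)
qed

end

section \<open>Multilinear maps on tensor powers\<close>

lemma free_extend_0 [simp]: "free_extend g 0 = 0"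
  by (simp add: free_extend_def)

lemma free_extend_minus: "free_extend g (- f) = - free_extend g f"
  using free_extend_diff[of g 0 f] by simp

lemma free_extend_sum: "free_extend g (\<Sum>i\<in>I. f i) = (\<Sum>i\<in>I. free_extend g (f i))"
  by (induction I rule: infinite_finite_induct) (auto simp: free_extend_add)

lemma subspace_tensor2_rel: "free.subspace (tensor2_rel scale)"
  by (simp add: tensor2_rel_def)

lemma subspace_tensor3_rel: "free.subspace (tensor3_rel scale)"
  by (simp add: tensor3_rel_def)

locale tensor_space = vector_space scale
  for scale :: "'k::field \<Rightarrow> 'v::ab_group_add \<Rightarrow> 'v"
begin

abbreviation class2 where "class2 \<equiv> coset (tensor2_rel scale)"
abbreviation class3 where "class3 \<equiv> coset (tensor3_rel scale)"
abbreviation proj2 where "proj2 \<equiv> proj (tensor2_rel scale)"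
abbreviation proj3 where "proj3 \<equiv> proj (tensor3_rel scale)"

definition t2 where "t2 a b = proj2 (gen2 a b)"
definition t3 where "t3 a b c = proj3 (gen3 a b c)"

lemmas class2_ops =
  coset_add_coset[OF subspace_tensor2_rel[of scale]]
  coset_minus_coset[OF subspace_tensor2_rel[of scale]]
  coset_uminus_coset[OF subspace_tensor2_rel[of scale]]
  coset_scale_coset[OF subspace_tensor2_rel[of scale]]

lemmas class3_ops =
  coset_add_coset[OF subspace_tensor3_rel[of scale]]
  coset_minus_coset[OF subspace_tensor3_rel[of scale]]
  coset_uminus_coset[OF subspace_tensor3_rel[of scale]]

lemmas class2_eq_iff = coset_eq_iff_proj[OF subspace_tensor2_rel[of scale]]
lemmas class3_eq_iff = coset_eq_iff_proj[OF subspace_tensor3_rel[of scale]]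

lemmas proj2_simps =
  proj_add[OF subspace_tensor2_rel[of scale]] proj_diff[OF subspace_tensor2_rel[of scale]]
  proj_minus[OF subspace_tensor2_rel[of scale]] proj_scale[OF subspace_tensor2_rel[of scale]]
  proj_sum[OF subspace_tensor2_rel[of scale]] proj_0[OF subspace_tensor2_rel[of scale]]
  t2_def[symmetric]

lemmas proj3_simps =
  proj_add[OF subspace_tensor3_rel[of scale]] proj_diff[OF subspace_tensor3_rel[of scale]]
  proj_minus[OF subspace_tensor3_rel[of scale]] proj_scale[OF subspace_tensor3_rel[of scale]]
  proj_sum[OF subspace_tensor3_rel[of scale]] proj_0[OF subspace_tensor3_rel[of scale]]
  t3_def[symmetric]

lemmas free_extend_simps =
  free_extend_add free_extend_diff free_extend_minus free_extend_sum

lemma t2_linear: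
  "t2 (a + a') b = t2 a b + t2 a' b"
  "t2 a (b + b') = t2 a b + t2 a b'"
  "t2 (scale k a) b = free_scale k (t2 a b)"
  "t2 a (scale k b) = free_scale k (t2 a b)"
proof -
  have *: "f \<in> tensor2_rel scale \<longleftrightarrow> proj2 f = 0" for f
    by (simp add: proj_eq_0_iff[OF subspace_tensor2_rel])
  have "gen2 (a + a') b - gen2 a b - gen2 a' b \<in> tensor2_rel scale"
    "gen2 a (b + b') - gen2 a b - gen2 a b' \<in> tensor2_rel scale"
    "gen2 (scale k a) b - free_scale k (gen2 a b) \<in> tensor2_rel scale"
    "gen2 a (scale k b) - free_scale k (gen2 a b) \<in> tensor2_rel scale"
    unfolding tensor2_rel_def by (rule free.span_base, blast)+
  thus "t2 (a + a') b = t2 a b + t2 a' b"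
  "t2 a (b + b') = t2 a b + t2 a b'"
  "t2 (scale k a) b = free_scale k (t2 a b)"
  "t2 a (scale k b) = free_scale k (t2 a b)"
    unfolding * by (simp_all add: proj2_simps diff_diff_eq)
qed

lemma t3_linear:
  "t3 (a + a') b c = t3 a b c + t3 a' b c"
  "t3 a (b + b') c = t3 a b c + t3 a b' c"
  "t3 a b (c + c') = t3 a b c + t3 a b c'"
  "t3 (scale k a) b c = free_scale k (t3 a b c)"
  "t3 a (scale k b) c = free_scale k (t3 a b c)"
  "t3 a b (scale k c) = free_scale k (t3 a b c)"
proof -
  have *: "f \<in> tensor3_rel scale \<longleftrightarrow> proj3 f = 0" for f
    by (simp add: proj_eq_0_iff[OF subspace_tensor3_rel])
  have "gen3 (a + a') b c - gen3 a b c - gen3 a' b c \<in> tensor3_rel scale"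
    "gen3 a (b + b') c - gen3 a b c - gen3 a b' c \<in> tensor3_rel scale"
    "gen3 a b (c + c') - gen3 a b c - gen3 a b c' \<in> tensor3_rel scale"
    "gen3 (scale k a) b c - free_scale k (gen3 a b c) \<in> tensor3_rel scale"
    "gen3 a (scale k b) c - free_scale k (gen3 a b c) \<in> tensor3_rel scale"
    "gen3 a b (scale k c) - free_scale k (gen3 a b c) \<in> tensor3_rel scale"
    unfolding tensor3_rel_def by (rule free.span_base; force)+
  thus  "t3 (a + a') b c = t3 a b c + t3 a' b c"
  "t3 a (b + b') c = t3 a b c + t3 a b' c"
  "t3 a b (c + c') = t3 a b c + t3 a b c'"
  "t3 (scale k a) b c = free_scale k (t3 a b c)"
  "t3 a (scale k b) c = free_scale k (t3 a b c)"
  "t3 a b (scale k c) = free_scale k (t3 a b c)"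
    unfolding * by (simp_all add: proj3_simps diff_diff_eq)
qed

lemma t2_diff:
  "t2 (a - a') b = t2 a b - t2 a' b"
  "t2 a (b - b') = t2 a b - t2 a b'"
  unfolding eq_diff_eq by (simp_all flip: t2_linear)

lemma t3_diff:
  "t3 (a - a') b c = t3 a b c - t3 a' b c"
  "t3 a (b - b') c = t3 a b c - t3 a b' c"
  "t3 a b (c - c') = t3 a b c - t3 a b c'"
  unfolding eq_diff_eq by (simp_all flip: t3_linear)

text \<open>
  A Sweedler sum is well defined as soon as its summand is bilinear modulo \<open>N\<close>, which is
  expressed here as exact bilinearity after \<open>proj N\<close>. In this form the side conditions are
  discharged by rewriting with \<open>t2_linear\<close> and \<open>t3_linear\<close>.
\<close>

lemma sweedler_bilinear:
  assumes N: "free.subspace N"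
    and "\<And>a a' b. proj N (g (a + a') b) = proj N (g a b) + proj N (g a' b)"
    and "\<And>a b b'. proj N (g a (b + b')) = proj N (g a b) + proj N (g a b')"
    and "\<And>k a b. proj N (g (scale k a) b) = free_scale k (proj N (g a b))"
    and "\<And>k a b. proj N (g a (scale k b)) = free_scale k (proj N (g a b))"
  shows "sweedler N (class2 f) (\<lambda>(a, b). coset N (g a b)) =
    coset N (free_extend (\<lambda>(a, b). g a b) f)"
  by (rule sweedler_tens2[OF N refl])
    (simp_all add: assms proj_diff[OF N] proj_scale[OF N] flip: proj_eq_0_iff[OF N])

lemmas sum22_class2 =
  sweedler_bilinear[OF subspace_tensor2_rel[of scale], folded sum22_def]

lemmas sum23_class2 =
  sweedler_bilinear[OF subspace_tensor3_rel[of scale], folded sum23_def]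

lemma tmap3_class3:
  assumes "Vector_Spaces.linear scale scale f" "Vector_Spaces.linear scale scale g"
    "Vector_Spaces.linear scale scale h"
  shows "tmap3 scale f g h (class3 u) =
    class3 (free_extend (\<lambda>(a, b, c). gen3 (f a) (g b) (h c)) u)"
proof -
  note N = subspace_tensor3_rel[of scale]
  note lin = assms[unfolded Vector_Spaces.linear_iff]
  show ?thesis unfolding tmap3_def
    by (rule sweedler_tens3[OF N tens3_def])
      (simp_all add: lin proj3_simps t3_linear flip: proj_eq_0_iff[OF N])
qed

lemma tmap2_class2:
  assumes "Vector_Spaces.linear scale scale f" "Vector_Spaces.linear scale scale g"
  shows "tmap2 scale f g (class2 u) =
    class2 (free_extend (\<lambda>(a, b). gen2 (f a) (g b)) u)"
proof -
  note lin = assms[unfolded Vector_Spaces.linear_iff]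
  show ?thesis unfolding tmap2_def tens2_def
    by (rule sum22_class2) (simp_all add: lin proj2_simps t2_linear)
qed

text \<open>
  For arbitrary sets these two equivalences fail; for cosets they turn an equation into
  a statement about the defect of its two sides.
\<close>

lemma diff_eq_zero2_iff:
  assumes "A \<in> range class2" "B \<in> range class2"
  shows "A \<ominus> B = zero2 scale \<longleftrightarrow> A = B"
proof -
  obtain f g where "A = class2 f" "B = class2 g" using assms by blast
  thus ?thesis by (simp add: class2_ops class2_eq_iff zero2_def proj2_simps)
qed

lemma diff_eq_zero3_iff:
  assumes "A \<in> range class3" "B \<in> range class3"
  shows "A \<ominus> B = zero3 scale \<longleftrightarrow> A = B"
proof -
  obtain f g where "A = class3 f" "B = class3 g" using assms by blast
  thus ?thesis by (simp add: class3_ops class3_eq_iff zero3_def proj3_simps)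
qed

text \<open>
  The coefficients of the formal sum are absorbed into the first factors, so that no scalars
  occur in later computations.
\<close>

lemma tensor2_eq_sum:
  assumes "t \<in> tensor2 scale"
  obtains I :: "('v \<times> 'v) set" and a b where "finite I" "t = class2 (\<Sum>i\<in>I. gen2 (a i) (b i))"
proof -
  obtain f where f: "t = class2 f" using assms by (auto simp: tensor2_def)
  have f_eq: "f = (\<Sum>i\<in>Poly_Mapping.keys f. free_scale (Poly_Mapping.lookup f i) (gen2 (fst i) (snd i)))"
    by (rule poly_mapping_eqI) (simp add: lookup_sum lookup_single when_def in_keys_iff if_distrib cong: if_cong)
  have "proj2 f = proj2 (\<Sum>i\<in>Poly_Mapping.keys f. gen2 (scale (Poly_Mapping.lookup f i) (fst i)) (snd i))"
    by (subst f_eq) (simp add: proj2_simps t2_linear, simp add: t2_def)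
  thus ?thesis using that[of "Poly_Mapping.keys f"] f by (simp add: class2_eq_iff)
qed

end


section \<open>The coproduct of an element of the tensor square\<close>

sublocale leibniz_algebra \<subseteq> tensor_space ..

context leibniz_algebra
begin

lemma br_linear:
  "br (x + y) z = br x z + br y z"
  "br x (y + z) = br x y + br x z"
  "br (scale k x) y = scale k (br x y)"
  "br x (scale k y) = scale k (br x y)"
  using linear_left linear_right unfolding Vector_Spaces.linear_iff by blast+

text \<open>
  Used from left to right, this brings every iterated bracket into right-nested form, in which
  the identities below hold term by term.
\<close>

lemma br_br_left: "br (br x y) z = br x (br y z) - br y (br x z)"
  using left_leibniz[of x y z] by simp

lemma linear_opL: "Vector_Spaces.linear scale scale (opL br x)"
  using linear_right[of x] by (simp add: opL_def[abs_def])

lemma linear_opR: "Vector_Spaces.linear scale scale (opR br x)"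
  using linear_left[of x] by (simp add: opR_def[abs_def])

end

text \<open>
  The terms of \<open>H\<close> are those that match only after the two copies of \<open>r\<close> have exchanged
  their names. An antisymmetric difference is asked for, instead of a symmetrised
  identity, because the latter would yield only twice the claim, which is empty in characteristic
  \<open>2\<close>.
\<close>

lemma sum_sum_eqI_antisym:
  fixes F G H :: "'i \<Rightarrow> 'i \<Rightarrow> 'x::ab_group_add"
  assumes "\<And>i j. F i j - G i j = H i j - H j i"
  shows "(\<Sum>i\<in>I. \<Sum>j\<in>I. F i j) = (\<Sum>i\<in>I. \<Sum>j\<in>I. G i j)"
proof -
  have "(\<Sum>i\<in>I. \<Sum>j\<in>I. F i j) - (\<Sum>i\<in>I. \<Sum>j\<in>I. G i j) =
      (\<Sum>i\<in>I. \<Sum>j\<in>I. H i j) - (\<Sum>i\<in>I. \<Sum>j\<in>I. H j i)"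
    by (simp add: assms flip: sum_subtractf)
  also have "(\<Sum>i\<in>I. \<Sum>j\<in>I. H j i) = (\<Sum>i\<in>I. \<Sum>j\<in>I. H i j)"
    by (rule sum.swap)
  finally show ?thesis by simp
qed

text \<open>
  A fixed presentation \<open>r = \<Sum>\<^sub>i a\<^sub>i \<otimes> b\<^sub>i\<close>. The formal sums defined here represent \<open>r\<close>, its
  flip and \<open>\<delta>\<^sub>r(x)\<close>; this is what \<open>flip2_r\<close> and \<open>delta_r_eq\<close> state.
\<close>

locale leibniz_tensor = leibniz_algebra scale br
  for scale :: "'k::field \<Rightarrow> 'v::ab_group_add \<Rightarrow> 'v"
    and br :: "'v \<Rightarrow> 'v \<Rightarrow> 'v" +
  fixes I :: "'i set" and a b :: "'i \<Rightarrow> 'v"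
begin

definition r_sum where "r_sum = (\<Sum>i\<in>I. gen2 (a i) (b i) :: _ \<Rightarrow>\<^sub>0 'k)"

definition flip_sum where "flip_sum = (\<Sum>i\<in>I. gen2 (b i) (a i) :: _ \<Rightarrow>\<^sub>0 'k)"

definition delta_sum where
  "delta_sum x = (\<Sum>i\<in>I. - gen2 (a i) (br (b i) x) + gen2 (br (b i) x) (a i) + gen2 (br x (b i)) (a i) :: _ \<Rightarrow>\<^sub>0 'k)"

abbreviation \<delta> where "\<delta> \<equiv> delta_r scale br (class2 r_sum)"

lemmas multilinear = t2_linear t3_linear br_linear
  free.scale_sum_right free.scale_right_distrib free.scale_right_diff_distrib free.scale_minus_right

lemmas sum_split = sum.distrib sum_subtractf sum_negf

lemma flip2_r: "flip2 scale (class2 r_sum) = class2 flip_sum"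
  by (simp add: flip2_def tens2_def sum22_class2 proj2_simps multilinear
      r_sum_def flip_sum_def free_extend_simps)

lemma delta_r_eq: "\<delta> x = class2 (delta_sum x)"
  by (simp add: delta_r_def tens2_def sum22_class2 proj2_simps multilinear class2_ops
      r_sum_def delta_sum_def free_extend_simps sum_split)

text \<open>
  The formal sum \<open>delta_sum x\<close> is linear in \<open>x\<close> only modulo the tensor relations.
\<close>

lemma proj2_delta_sum_add: "proj2 (delta_sum (x + y)) = proj2 (delta_sum x + delta_sum y)"
  by (simp add: delta_sum_def proj2_simps multilinear sum_split)

lemma proj2_delta_sum_scale: "proj2 (delta_sum (scale k x)) = proj2 (free_scale k (delta_sum x))"
  by (simp add: delta_sum_def proj2_simps multilinear sum_split)

lemma delta_r_linear:
  "\<delta> x \<in> tensor2 scale"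
  "\<delta> (x + y) = \<delta> x \<oplus> \<delta> y"
  "\<delta> (scale k x) = coset_scale (tensor2_rel scale) k (\<delta> x)"
  by (simp_all add: delta_r_eq tensor2_def class2_ops class2_eq_iff proj2_delta_sum_add proj2_delta_sum_scale)

lemma sum22_delta:
  assumes "\<And>a a' b. proj2 (g (a + a') b) = proj2 (g a b) + proj2 (g a' b)"
    and "\<And>a b b'. proj2 (g a (b + b')) = proj2 (g a b) + proj2 (g a b')"
    and "\<And>k a b. proj2 (g (scale k a) b) = free_scale k (proj2 (g a b))"
    and "\<And>k a b. proj2 (g a (scale k b)) = free_scale k (proj2 (g a b))"
  shows "sum22 scale (\<delta> x) (\<lambda>a b. class2 (g a b)) = class2 (free_extend (\<lambda>(a, b). g a b) (delta_sum x))"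
  unfolding delta_r_eq by (rule sum22_class2) (fact assms)+


section \<open>The two compatibility conditions\<close>

text \<open>
  The comparisons below take two rounds of rewriting. The first one writes both sides as the class of
  a formal sum while \<open>r_sum\<close> and \<open>delta_sum\<close> stay folded, because \<open>sum22_delta\<close> recognises
  \<open>\<delta> x\<close> only in this form; the second one expands everything into values of \<open>t2\<close>.
\<close>

lemmas to_class2 = tens2_def tens3_def sum22_delta tmap2_class2 linear_opL linear_opR class2_ops
  proj2_simps multilinear zero2_def

lemmas expand_class2 = proj2_simps multilinear t2_diff
  free_extend_simps delta_sum_def r_sum_def flip_sum_def sum_split
  opL_def opR_def br_br_left

text \<open>
  In \<open>x\<^sub>(\<^sub>2\<^sub>) \<otimes> [x\<^sub>(\<^sub>1\<^sub>), y]\<close> the terms \<open>r\<^sup>1 \<otimes> [[r\<^sup>2, x] + [x, r\<^sup>2], y]\<close> vanish by the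
  Leibniz rule and \<open>- (R\<^sub>x \<otimes> R\<^sub>y)(\<sigma>(r))\<close> remains; in the same way
  \<open>[y\<^sub>(\<^sub>1\<^sub>), x] \<otimes> y\<^sub>(\<^sub>2\<^sub>)\<close> reduces to \<open>- (R\<^sub>x \<otimes> R\<^sub>y)(r)\<close>.
\<close>

lemma compat_zero_iff:
  "zero2 scale = sum22 scale (\<delta> x) (\<lambda>x1 x2. tens2 scale x2 (br x1 y))
      \<ominus> sum22 scale (\<delta> y) (\<lambda>y1 y2. tens2 scale (br y1 x) y2)
   \<longleftrightarrow> tmap2 scale (opR br x) (opR br y) (class2 r_sum \<ominus> class2 flip_sum) = zero2 scale"
proof -
  have "sum22 scale (\<delta> x) (\<lambda>x1 x2. tens2 scale x2 (br x1 y))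
      \<ominus> sum22 scale (\<delta> y) (\<lambda>y1 y2. tens2 scale (br y1 x) y2)
     = tmap2 scale (opR br x) (opR br y) (class2 r_sum \<ominus> class2 flip_sum)"
    by (simp add: to_class2 class2_eq_iff) (simp add: expand_class2)
  thus ?thesis by auto
qed

text \<open>
  Six of the mixed terms on the right-hand side cancel in pairs: those with \<open>[r\<^sup>2, x]\<close> in one
  factor, coming from \<open>\<delta>(x)\<close>, and \<open>[r\<^sup>1, y]\<close> or \<open>[y, r\<^sup>1]\<close> in the other.
  The other six carry \<open>L\<^sub>x\<close> in one factor and form the right-hand side of the equivalence. The terms
  with \<open>x\<close> and \<open>y\<close> in the same factor agree with \<open>\<delta>([x, y])\<close>.
\<close>

lemma compat_bracket_iff:
  "\<delta> (br x y) =
         sum22 scale (\<delta> x) (\<lambda>x1 x2. tens2 scale x1 (br x2 y))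
       \<ominus> sum22 scale (\<delta> x) (\<lambda>x1 x2. tens2 scale (br y x1) x2)
       \<ominus> sum22 scale (\<delta> x) (\<lambda>x1 x2. tens2 scale (br x1 y) x2)
       \<oplus> sum22 scale (\<delta> x) (\<lambda>x1 x2. tens2 scale x2 (br x1 y))
       \<ominus> sum22 scale (\<delta> x) (\<lambda>x1 x2. tens2 scale (br y x2) x1)
       \<ominus> sum22 scale (\<delta> x) (\<lambda>x1 x2. tens2 scale (br x2 y) x1)
       \<oplus> sum22 scale (\<delta> y) (\<lambda>y1 y2. tens2 scale (br x y1) y2)
       \<oplus> sum22 scale (\<delta> y) (\<lambda>y1 y2. tens2 scale y1 (br x y2))
    \<longleftrightarrow> tmap2 scale (opL br x) (opR br y) (class2 r_sum \<ominus> class2 flip_sum)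
         \<oplus> tmap2 scale (opL br y) (opL br x) (class2 r_sum \<ominus> class2 flip_sum)
         \<oplus> tmap2 scale (opR br y) (opL br x) (class2 r_sum \<ominus> class2 flip_sum) = zero2 scale"
    (is "_ = ?rhs \<longleftrightarrow> ?cond = _")
proof -
  have "\<delta> (br x y) \<ominus> ?rhs = ?cond"
    by (simp add: to_class2 class2_eq_iff delta_r_eq[of "br x y"]) (simp add: expand_class2)
  moreover have "?rhs \<in> range class2"
    by (simp add: to_class2)
  ultimately show ?thesis
    using diff_eq_zero2_iff[of "\<delta> (br x y)" ?rhs] by (simp add: delta_r_eq)
qed

section \<open>The co-Leibniz identity\<close>

text \<open>
  The nested sums of the co-Leibniz identity differ in the order of the three factors and
  in the leg of \<open>\<delta> x\<close> to which \<open>\<delta>\<close> is applied again. The order is absorbed into \<open>h\<close>,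
  whose first argument is the leg left alone; the choice of leg accounts for the two
  statements.
\<close>

lemma sum23_sum23_delta:
  assumes "\<And>u u' v w. proj3 (h (u + u') v w) = proj3 (h u v w) + proj3 (h u' v w)"
    and "\<And>u v v' w. proj3 (h u (v + v') w) = proj3 (h u v w) + proj3 (h u v' w)"
    and "\<And>u v w w'. proj3 (h u v (w + w')) = proj3 (h u v w) + proj3 (h u v w')"
    and "\<And>k u v w. proj3 (h (scale k u) v w) = free_scale k (proj3 (h u v w))"
    and "\<And>k u v w. proj3 (h u (scale k v) w) = free_scale k (proj3 (h u v w))"
    and "\<And>k u v w. proj3 (h u v (scale k w)) = free_scale k (proj3 (h u v w))"
  shows "sum23 scale (\<delta> x) (\<lambda>x1 x2. sum23 scale (\<delta> x2) (\<lambda>x21 x22. class3 (h x1 x21 x22))) =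
    class3 (free_extend (\<lambda>(x1, x2). free_extend (\<lambda>(x21, x22). h x1 x21 x22) (delta_sum x2)) (delta_sum x))"
    and "sum23 scale (\<delta> x) (\<lambda>x1 x2. sum23 scale (\<delta> x1) (\<lambda>x11 x12. class3 (h x2 x11 x12))) =
    class3 (free_extend (\<lambda>(x1, x2). free_extend (\<lambda>(x11, x12). h x2 x11 x12) (delta_sum x1)) (delta_sum x))"
proof -
  have inner: "sum23 scale (\<delta> y) (\<lambda>v w. class3 (h u v w)) =
      class3 (free_extend (\<lambda>(v, w). h u v w) (delta_sum y))" for u y
    unfolding delta_r_eq by (rule sum23_class2) (fact assms)+
  note expand = proj3_simps free_extend_simps delta_sum_def assms multilinear sum_split
  show "sum23 scale (\<delta> x) (\<lambda>x1 x2. sum23 scale (\<delta> x2) (\<lambda>x21 x22. class3 (h x1 x21 x22))) =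
    class3 (free_extend (\<lambda>(x1, x2). free_extend (\<lambda>(x21, x22). h x1 x21 x22) (delta_sum x2)) (delta_sum x))"
    unfolding inner unfolding delta_r_eq by (rule sum23_class2) (simp_all add: expand)
  show "sum23 scale (\<delta> x) (\<lambda>x1 x2. sum23 scale (\<delta> x1) (\<lambda>x11 x12. class3 (h x2 x11 x12))) =
    class3 (free_extend (\<lambda>(x1, x2). free_extend (\<lambda>(x11, x12). h x2 x11 x12) (delta_sum x1)) (delta_sum x))"
    unfolding inner unfolding delta_r_eq by (rule sum23_class2) (simp_all add: expand)
qed

lemma co_leibniz_defect:
  "sum23 scale (\<delta> x) (\<lambda>x1 x2. sum23 scale (\<delta> x2) (\<lambda>x21 x22. tens3 scale x1 x21 x22)) \<ominus>
      (sum23 scale (\<delta> x) (\<lambda>x1 x2. sum23 scale (\<delta> x1) (\<lambda>x11 x12. tens3 scale x11 x12 x2)) \<oplus>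
       sum23 scale (\<delta> x) (\<lambda>x1 x2. sum23 scale (\<delta> x2) (\<lambda>x21 x22. tens3 scale x21 x1 x22))) =
   class3
     (free_extend (\<lambda>(x1, x2). free_extend (\<lambda>(x21, x22). gen3 x1 x21 x22) (delta_sum x2)) (delta_sum x)
   - (free_extend (\<lambda>(x1, x2). free_extend (\<lambda>(x11, x12). gen3 x11 x12 x2) (delta_sum x1)) (delta_sum x)
    + free_extend (\<lambda>(x1, x2). free_extend (\<lambda>(x21, x22). gen3 x21 x1 x22) (delta_sum x2)) (delta_sum x)))"
  unfolding tens3_def
  by (simp add: sum23_sum23_delta[where h = "\<lambda>u v w. gen3 u v w"]
    sum23_sum23_delta[where h = "\<lambda>u v w. gen3 v w u"]
    sum23_sum23_delta[where h = "\<lambda>u v w. gen3 v u w"] proj3_simps multilinear class3_ops)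

lemma sum23_sum23:
  fixes p q p' q' :: "'i \<Rightarrow> 'v"
  assumes "\<And>u u' v w z. proj3 (h (u + u') v w z) = proj3 (h u v w z) + proj3 (h u' v w z)"
    and "\<And>u v v' w z. proj3 (h u (v + v') w z) = proj3 (h u v w z) + proj3 (h u v' w z)"
    and "\<And>u v w w' z. proj3 (h u v (w + w') z) = proj3 (h u v w z) + proj3 (h u v w' z)"
    and "\<And>u v w z z'. proj3 (h u v w (z + z')) = proj3 (h u v w z) + proj3 (h u v w z')"
    and "\<And>k u v w z. proj3 (h (scale k u) v w z) = free_scale k (proj3 (h u v w z))"
    and "\<And>k u v w z. proj3 (h u (scale k v) w z) = free_scale k (proj3 (h u v w z))"
    and "\<And>k u v w z. proj3 (h u v (scale k w) z) = free_scale k (proj3 (h u v w z))"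
    and "\<And>k u v w z. proj3 (h u v w (scale k z)) = free_scale k (proj3 (h u v w z))"
  shows "sum23 scale (class2 (\<Sum>i\<in>I. gen2 (p i) (q i)))
      (\<lambda>s1 s2. sum23 scale (class2 (\<Sum>j\<in>I. gen2 (p' j) (q' j))) (\<lambda>t1 t2. class3 (h s1 s2 t1 t2))) =
    class3 (\<Sum>i\<in>I. \<Sum>j\<in>I. h (p i) (q i) (p' j) (q' j))"
proof -
  have inner: "sum23 scale (class2 (\<Sum>j\<in>I. gen2 (p' j) (q' j))) (\<lambda>t1 t2. class3 (h s1 s2 t1 t2)) =
      class3 (\<Sum>j\<in>I. h s1 s2 (p' j) (q' j))" for s1 s2
    by (subst sum23_class2) (simp_all add: assms free_extend_simps)
  show ?thesis
    unfolding inner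
    by (subst sum23_class2) (simp_all add: assms free_extend_simps proj3_simps sum.distrib free.scale_sum_right)
qed

lemma tensor_products_eq:
  fixes p q p' q' :: "'i \<Rightarrow> 'v"
  defines "s \<equiv> (\<Sum>i\<in>I. gen2 (p i) (q i) :: _ \<Rightarrow>\<^sub>0 'k)"
  defines "t \<equiv> (\<Sum>i\<in>I. gen2 (p' i) (q' i) :: _ \<Rightarrow>\<^sub>0 'k)"
  shows "prod12_23 scale br (class2 s) (class2 t) = class3 (\<Sum>i\<in>I. \<Sum>j\<in>I. gen3 (p i) (br (q i) (p' j)) (q' j))"
    and "prod13_23 scale br (class2 s) (class2 t) = class3 (\<Sum>i\<in>I. \<Sum>j\<in>I. gen3 (p i) (p' j) (br (q i) (q' j)))"
    and "prod23_12 scale br (class2 s) (class2 t) = class3 (\<Sum>i\<in>I. \<Sum>j\<in>I. gen3 (p' j) (br (p i) (q' j)) (q i))"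
    and "prod23_13 scale br (class2 s) (class2 t) = class3 (\<Sum>i\<in>I. \<Sum>j\<in>I. gen3 (p' j) (p i) (br (q i) (q' j)))"
    and "prod12_13 scale br (class2 s) (class2 t) = class3 (\<Sum>i\<in>I. \<Sum>j\<in>I. gen3 (br (p i) (p' j)) (q i) (q' j))"
    and "prod13_12 scale br (class2 s) (class2 t) = class3 (\<Sum>i\<in>I. \<Sum>j\<in>I. gen3 (br (p i) (p' j)) (q' j) (q i))"
  unfolding prod12_23_def prod13_23_def prod23_12_def prod23_13_def prod12_13_def prod13_12_def tens3_def s_def t_def
  by (rule sum23_sum23; simp add: proj3_simps multilinear)+

text \<open>
  The terms of the defect with
  \<open>x\<close> in the middle factor are, up to interchanging the two copies of \<open>r\<close>, values of
  \<open>id \<otimes> (L\<^sub>x + R\<^sub>x) \<otimes> id\<close>; the Leibniz rule enters for the product whose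
  bracket itself stands in the middle. The first factor behaves in the same way, and in the
  last factor \<open>R\<^sub>x\<close> takes the place of \<open>L\<^sub>x + R\<^sub>x\<close>.
\<close>

lemma co_leibniz_iff:
  "sum23 scale (\<delta> x) (\<lambda>x1 x2. sum23 scale (\<delta> x2) (\<lambda>x21 x22. tens3 scale x1 x21 x22)) =
      (sum23 scale (\<delta> x) (\<lambda>x1 x2. sum23 scale (\<delta> x1) (\<lambda>x11 x12. tens3 scale x11 x12 x2)) \<oplus>
       sum23 scale (\<delta> x) (\<lambda>x1 x2. sum23 scale (\<delta> x2) (\<lambda>x21 x22. tens3 scale x21 x1 x22)))
   \<longleftrightarrow> 
       (let r = class2 r_sum; r\<sigma> = class2 flip_sum;
            A = prod12_23 scale br r r\<sigma> \<oplus> prod13_23 scale br r r\<sigma>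
              \<ominus> prod12_13 scale br r r\<sigma> \<ominus> prod13_12 scale br r\<sigma> r;
            B = prod12_23 scale br r r \<oplus> prod13_23 scale br r r
              \<ominus> prod12_13 scale br r\<sigma> r \<ominus> prod13_12 scale br r r\<sigma>;
            C = prod23_13 scale br r r\<sigma> \<oplus> prod12_13 scale br r\<sigma> r\<sigma>
              \<ominus> prod23_12 scale br r\<sigma> r\<sigma> \<ominus> prod12_23 scale br r\<sigma> r\<sigma>
        in (tmap3 scale id (opL br x) id A \<oplus> tmap3 scale id (opR br x) id A)
         \<ominus> tmap3 scale id id (opR br x) B
         \<ominus> (tmap3 scale (opL br x) id id C \<oplus> tmap3 scale (opR br x) id id C)) = zero3 scale"
  (is "?lhs = ?rhs \<longleftrightarrow> ?cond = _")
proof -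
  \<comment> \<open>The terms of the defect that correspond to a term of the condition with \<open>i\<close> and \<open>j\<close>
    interchanged, or that remain when the iterated brackets have been nested to the right: first those
    with \<open>x\<close> in the middle factor, then those with \<open>x\<close> in the last one, then in the first.\<close>
  define H where "H i j =
      t3 (a j) (br (b j) (br (b i) x + br x (b i))) (a i)
    + t3 (a j) (br (b i) x + br x (b i)) (br (b j) (a i))
    - t3 (br (b j) (a i)) (br (b i) x + br x (b i)) (a j)
    + t3 (br (b j) (a i)) (a j) (br (b i) x)
    - t3 (a j) (br (b j) (a i)) (br (b i) x)
    - t3 (a j) (a i) (br (b j) (br (b i) x))
    - t3 (br (b j) (br (b i) x + br x (b i))) (a j) (a i)
    - t3 (br (b i) x + br x (b i)) (a j) (br (b j) (a i))
    + t3 (br (b i) x + br x (b i)) (br (b j) (a i)) (a j)" for i j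
  have "?lhs \<ominus> ?rhs = ?cond"
    unfolding co_leibniz_defect Let_def
    apply (simp add: r_sum_def flip_sum_def tensor_products_eq class3_ops tmap3_class3
        linear_opL linear_opR linear_id class3_eq_iff)
    \<comment> \<open>Each side is collected into a single double sum over \<open>I\<close>.\<close>
    apply (simp add: free_extend_simps delta_sum_def proj3_simps opL_def opR_def
        flip: sum.distrib sum_subtractf sum_negf)
    apply (rule sum_sum_eqI_antisym[where H = H])
    apply (simp add: H_def multilinear t3_diff br_br_left algebra_simps)
    done
  moreover have "?lhs \<in> range class3" "?rhs \<in> range class3"
    by (simp_all add: sum23_def sweedler_def class3_ops)
  ultimately show ?thesis using diff_eq_zero3_iff[of ?lhs ?rhs] by simp
qed

end

theorem theorem2p6:
  fixes scale :: "'k::field \<Rightarrow> 'v::ab_group_add \<Rightarrow> 'v"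
    and br :: "'v \<Rightarrow> 'v \<Rightarrow> 'v"
    and r r\<sigma> :: "('v \<times> 'v \<Rightarrow>\<^sub>0 'k) set"
  assumes "leibniz_algebra scale br"
    and "r \<in> tensor2 scale"
    and "r\<sigma> = flip2 scale r"
  shows "leibniz_bialgebra scale br (delta_r scale br r) \<longleftrightarrow>
    (\<forall>x y. tmap2 scale (opR br x) (opR br y) (r \<ominus> r\<sigma>) = zero2 scale) \<and>
    (\<forall>x y. tmap2 scale (opL br x) (opR br y) (r \<ominus> r\<sigma>)
         \<oplus> tmap2 scale (opL br y) (opL br x) (r \<ominus> r\<sigma>)
         \<oplus> tmap2 scale (opR br y) (opL br x) (r \<ominus> r\<sigma>) = zero2 scale) \<and>
    (\<forall>x.
       (let A = prod12_23 scale br r r\<sigma> \<oplus> prod13_23 scale br r r\<sigma>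
              \<ominus> prod12_13 scale br r r\<sigma> \<ominus> prod13_12 scale br r\<sigma> r;
            B = prod12_23 scale br r r \<oplus> prod13_23 scale br r r
              \<ominus> prod12_13 scale br r\<sigma> r \<ominus> prod13_12 scale br r r\<sigma>;
            C = prod23_13 scale br r r\<sigma> \<oplus> prod12_13 scale br r\<sigma> r\<sigma>
              \<ominus> prod23_12 scale br r\<sigma> r\<sigma> \<ominus> prod12_23 scale br r\<sigma> r\<sigma>
        in (tmap3 scale id (opL br x) id A \<oplus> tmap3 scale id (opR br x) id A)
         \<ominus> tmap3 scale id id (opR br x) B
         \<ominus> (tmap3 scale (opL br x) id id C \<oplus> tmap3 scale (opR br x) id id C)) = zero3 scale)"
proof -
  interpret leibniz_algebra scale br by fact
  obtain I :: "('v \<times> 'v) set" and a b where r_eq: "r = class2 (\<Sum>i\<in>I. gen2 (a i) (b i))"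
    using tensor2_eq_sum[OF assms(2)] .
  interpret leibniz_tensor scale br I a b ..
  have r: "r = class2 r_sum" by (simp add: r_eq r_sum_def)
  have r\<sigma>: "r\<sigma> = class2 flip_sum" by (simp add: assms(3) r flip2_r)
  have "leibniz_bialgebra scale br \<delta> \<longleftrightarrow>
      leibniz_coalgebra_axioms scale \<delta> \<and> leibniz_bialgebra_axioms scale br \<delta>"
    by (auto simp: leibniz_bialgebra_def leibniz_coalgebra_def leibniz_algebra_axioms vector_space_axioms)
  thus ?thesis
    unfolding r r\<sigma> leibniz_coalgebra_axioms_def leibniz_bialgebra_axioms_def
      compat_zero_iff compat_bracket_iff co_leibniz_iff Let_def
    using delta_r_linear by blast
qed

end
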